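(* $N(108) \ge 9$; that is, there exist $9$ mutually orthogonal Latin squares of order $108$.
   Context: Let $n$ be a positive integer. A Latin square of order $n$ on an $n$-element set $V$ is an $n \times n$ array with entries in $V$ such that every row and every column is a permutation of $V$. Two Latin squares $L_1=(v_{ij})$ on $V$ and $L_2=(w_{ij})$ on $W$ (with $|V|=|W|=n$) are called orthogonal if the set of all entries of the array $((v_{ij},w_{ij}))$ is the whole Cartesian product $V\times W$. A set of $t$ mutually orthogonal Latin squares (MOLS) of order $n$ consists of $t$ Latin squares of order $n$ which are pairwise orthogonal. $N(n)$ denotes the size of the largest set of MOLS of order $n$. *)

theory Defs
  imports Main "HOL-Library.Extended_Nat"
begin

text \<open>An \<open>n \<times> n\<close> array is a function of a row index and a column index; only its values
  at indices below \<open>n\<close> matter.\<close>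

definition latin_square :: "nat \<Rightarrow> 'a set \<Rightarrow> (nat \<Rightarrow> nat \<Rightarrow> 'a) \<Rightarrow> bool" where
  "latin_square n V L \<longleftrightarrow>
     0 < n \<and> finite V \<and> card V = n \<and>
     (\<forall>i<n. bij_betw (\<lambda>j. L i j) {..<n} V) \<and>
     (\<forall>j<n. bij_betw (\<lambda>i. L i j) {..<n} V)"

definition orthogonal_squares ::
    "nat \<Rightarrow> 'a set \<Rightarrow> (nat \<Rightarrow> nat \<Rightarrow> 'a) \<Rightarrow> 'b set \<Rightarrow> (nat \<Rightarrow> nat \<Rightarrow> 'b) \<Rightarrow> bool" where
  "orthogonal_squares n V L W M \<longleftrightarrow>
     (\<lambda>(i, j). (L i j, M i j)) ` ({..<n} \<times> {..<n}) = V \<times> W"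

text \<open>The squares are indexed by \<open>k < t\<close>, and the \<open>k\<close>-th one has its own symbol set \<open>V k\<close>.
  For \<open>n \<ge> 2\<close> orthogonality forces squares with different indices to be different.\<close>

definition mols :: "nat \<Rightarrow> nat \<Rightarrow> (nat \<Rightarrow> 'a set) \<Rightarrow> (nat \<Rightarrow> nat \<Rightarrow> nat \<Rightarrow> 'a) \<Rightarrow> bool" where
  "mols n t V L \<longleftrightarrow>
     (\<forall>k<t. latin_square n (V k) (L k)) \<and>
     (\<forall>k<t. \<forall>l<t. k \<noteq> l \<longrightarrow> orthogonal_squares n (V k) (L k) (V l) (L l))"

text \<open>Symbols may be taken in \<open>nat\<close>, since renaming the symbols of each square separately
  preserves both the Latin property and orthogonality. For \<open>n \<ge> 2\<close> the possible sizes are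
  bounded by \<open>n - 1\<close>, so the supremum is a maximum; for \<open>n = 1\<close> it is \<open>\<infinity>\<close>.\<close>

definition N :: "nat \<Rightarrow> enat" where
  "N n = Sup {enat t | t. \<exists>(V :: nat \<Rightarrow> nat set) L. mols n t V L}"

end

theory Submission
  imports Defs "HOL-Library.Numeral_Type" "HOL-Library.Product_Plus"
begin

text \<open>
  Nine squares of order 108 come from a difference matrix over a group \<open>G\<close> of order 108: ten
  functions from a set of 108 columns to \<open>G\<close> such that the difference of any two of them is
  injective (\<open>mols_of_difference_matrix\<close>). Here \<open>G\<close> is \<open>(\<int>/2)\<^sup>2 \<times> F\<close> with \<open>F\<close> the field of 27
  elements, presented as \<open>\<int>/3[t]\<close> with \<open>t\<^sup>3 = t + 2\<close>. The number of conditions is kept small by a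
  group of translations. Let \<open>W\<close> be the plane spanned by \<open>1\<close> and \<open>t\<close> in \<open>F\<close>, and choose distinct
  elements \<open>a\<^sub>k\<close> of \<open>F\<close>. There are only 12 base columns \<open>j\<close>, and the 108 columns are
  the pairs \<open>(j, w)\<close> with \<open>w \<in> W\<close>; row \<open>k\<close> has there the entry \<open>(h\<^sub>k(j), b\<^sub>k(j) + a\<^sub>k w)\<close>.

  For rows \<open>k\<close> and \<open>l\<close> put \<open>d = a\<^sub>k - a\<^sub>l\<close>. The difference of the two rows runs, for fixed \<open>j\<close>,
  through a coset of \<open>d W\<close>, and the cosets of \<open>d W\<close> in \<open>F\<close> are told apart by the coefficient of
  \<open>t\<^sup>2\<close> in \<open>x / d\<close>. So the rows are compatible as soon as the 12 pairs consisting of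
  \<open>h\<^sub>k(j) - h\<^sub>l(j)\<close> and the \<open>t\<^sup>2\<close>-coefficient of \<open>(b\<^sub>k(j) - b\<^sub>l(j)) / d\<close> are distinct
  (\<open>inj_on_add_translates\<close>, \<open>inj_on_dm_entry_diff\<close>). They then fill the 12-element set
  \<open>(\<int>/2)\<^sup>2 \<times> \<int>/3\<close>.

  This condition also shows how to find the entries. It forces each difference of \<open>h\<^sub>k\<close> and \<open>h\<^sub>l\<close> to
  occur for exactly three \<open>j\<close>, and asks that the three \<open>t\<^sup>2\<close>-coefficients belonging to one difference
  be distinct in \<open>\<int>/3\<close>: their sum is zero, and they are not all equal. Once \<open>h\<close> and \<open>a\<close> are
  chosen, the conditions on the sums are linear equations for \<open>b\<close> over \<open>\<int>/3\<close>, with a large space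
  of solutions, and in that space finitely many linear forms have to be non-zero. Requiring a
  symmetry of order three cuts the space down far enough for a quick search. The resulting tables
  are verified in \<open>separated_table\<close>.
\<close>

section \<open>Latin squares from difference matrices\<close>

text \<open>
  Rows of the squares are indexed by the columns of the matrix, columns of the squares by the group,
  and the \<open>k\<close>-th square is \<open>(c, y) \<mapsto> f k c - f t c + y\<close>. Two cells in which the squares \<open>k\<close> and \<open>l\<close>
  show the same pair of symbols have the same value of \<open>f k c - f l c\<close>, since \<open>f t c\<close> and \<open>y\<close>
  cancel; hence they have the same \<open>c\<close>, and then the same \<open>y\<close>. Subtracting the last row costs one
  of the \<open>t + 1\<close> rows, and is what makes the columns of a square permutations.
\<close>

lemma mols_of_difference_matrix:
  fixes f :: "nat \<Rightarrow> 'c \<Rightarrow> 'g :: {group_add, finite}"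
  assumes card: "card C = CARD('g)"
    and dm: "\<And>k l. k \<le> t \<Longrightarrow> l \<le> t \<Longrightarrow> k \<noteq> l \<Longrightarrow> inj_on (\<lambda>c. f k c - f l c) C"
  shows "\<exists>(V :: nat \<Rightarrow> nat set) L. mols (CARD('g)) t V L"
proof -
  define n where "n = CARD('g)"
  have n: "0 < n" by (simp add: n_def)
  then have "finite C" using card by (simp add: n_def card_ge_0_finite)
  then obtain r where r: "bij_betw r {..<n} C"
    using card ex_bij_betw_nat_finite[of C] by (auto simp: n_def atLeast0LessThan)
  obtain e where e: "bij_betw e (UNIV :: 'g set) {..<n}"
    using ex_bij_betw_finite_nat[of "UNIV :: 'g set"] by (auto simp: n_def atLeast0LessThan)
  define g where "g = inv e"
  have inj_e: "inj e" using e by (simp add: bij_betw_def)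
  have e_less: "e x < n" for x using e by (auto simp: bij_betw_def)
  have inj_g: "inj_on g {..<n}"
    using e inj_on_inv_into[of "{..<n}" e UNIV] by (simp add: g_def bij_betw_def)
  have inj_r: "inj_on r {..<n}" and r_in: "\<And>i. i < n \<Longrightarrow> r i \<in> C"
    using r by (auto simp: bij_betw_def)
  \<comment> \<open>The matrix after normalizing its last row to zero, so that \<open>d t\<close> vanishes.\<close>
  define d where "d k i = f k (r i) - f t (r i)" for k i
  define L where "L k i j = e (d k i + g j)" for k i j
  have inj_diff: "i = i'"
    if "k \<le> t" "l \<le> t" "k \<noteq> l" "i < n" "i' < n" "d k i - d l i = d k i' - d l i'" for k l i i'
  proof -
    have "f k (r i) - f l (r i) = f k (r i') - f l (r i')"
      using that(6) by (simp add: d_def diff_diff_eq2)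
    then have "r i = r i'" using inj_onD[OF dm[OF that(1-3)]] r_in that by blast
    then show ?thesis using inj_onD[OF inj_r] that by blast
  qed
  have cancel: "(x + z) - (y + z) = x - y" for x y z :: 'g
    by (simp only: diff_conv_add_uminus minus_add add.assoc add_minus_cancel)
  have bijI: "bij_betw h {..<n} {..<n}" if "inj_on h {..<n}" "\<And>x. h x < n" for h :: "nat \<Rightarrow> nat"
    using that unfolding bij_betw_def by (intro conjI endo_inj_surj) auto
  have latin: "latin_square n {..<n} (L k)" if "k < t" for k
    unfolding latin_square_def
  proof (intro conjI allI impI)
    fix i assume "i < n"
    have "inj_on (\<lambda>j. L k i j) {..<n}"
    proof (rule inj_onI)
      fix j j' assume "j \<in> {..<n}" "j' \<in> {..<n}" "L k i j = L k i j'"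
      then have "g j = g j'" by (simp add: L_def inj_eq[OF inj_e])
      then show "j = j'"
        using inj_onD[OF inj_g] \<open>j \<in> {..<n}\<close> \<open>j' \<in> {..<n}\<close> by blast
    qed
    then show "bij_betw (\<lambda>j. L k i j) {..<n} {..<n}"
      by (rule bijI) (simp add: L_def e_less)
  next
    fix j assume "j < n"
    have "inj_on (\<lambda>i. L k i j) {..<n}"
    proof (rule inj_onI)
      fix i i' assume "i \<in> {..<n}" "i' \<in> {..<n}" "L k i j = L k i' j"
      then show "i = i'"
        using inj_diff[of k t i i'] \<open>k < t\<close> by (simp add: L_def d_def inj_eq[OF inj_e])
    qed
    then show "bij_betw (\<lambda>i. L k i j) {..<n} {..<n}"
      by (rule bijI) (simp add: L_def e_less)
  qed (use n in auto)
  have orth: "orthogonal_squares n {..<n} (L k) {..<n} (L l)" if kl: "k < t" "l < t" "k \<noteq> l" for k l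
  proof -
    have "inj_on (\<lambda>(i, j). (L k i j, L l i j)) ({..<n} \<times> {..<n})"
    proof (rule inj_onI, clarsimp)
      fix i j i' j' assume ij: "i < n" "j < n" "i' < n" "j' < n"
        and eq: "L k i j = L k i' j'" "L l i j = L l i' j'"
      have k: "d k i + g j = d k i' + g j'" and l: "d l i + g j = d l i' + g j'"
        using eq by (simp_all add: L_def inj_eq[OF inj_e])
      have "d k i - d l i = (d k i + g j) - (d l i + g j)" by (simp only: cancel)
      also have "\<dots> = d k i' - d l i'" by (simp only: k l cancel)
      finally have "i = i'" using inj_diff[of k l] kl ij by simp
      then show "i = i' \<and> j = j'" using k inj_onD[OF inj_g] ij by simp
    qed
    then show ?thesis unfolding orthogonal_squares_def
      by (intro endo_inj_surj) (auto simp: L_def e_less)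
  qed
  have "mols n t (\<lambda>_. {..<n}) L" using latin orth by (simp add: mols_def)
  then show ?thesis unfolding n_def by blast
qed

text \<open>
  The idea of developing a few base columns by translations: \<open>\<phi>\<close> is constant on each translate of
  the image of \<open>\<delta>\<close>, so it recovers the base column \<open>j\<close> from a developed value, and injectivity of \<open>\<delta>\<close>
  recovers the translation.
\<close>

lemma inj_on_add_translates:
  fixes \<beta> :: "'j \<Rightarrow> 'b :: ab_group_add" and \<delta> :: "'w \<Rightarrow> 'b" and \<phi> :: "'b \<Rightarrow> 'c :: ab_group_add"
  assumes add: "\<And>x y. \<phi> (x + y) = \<phi> x + \<phi> y"
    and kernel: "\<And>w. \<phi> (\<delta> w) = 0"
    and inj: "inj \<delta>"
    and separates: "inj_on (\<lambda>j. (\<gamma> j, \<phi> (\<beta> j))) J"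
  shows "inj_on (\<lambda>(j, w). (\<gamma> j, \<beta> j + \<delta> w)) (J \<times> UNIV)"
proof (rule inj_onI, clarsimp)
  fix j w j' w'
  assume j: "j \<in> J" "j' \<in> J" and h: "\<gamma> j = \<gamma> j'" and b: "\<beta> j + \<delta> w = \<beta> j' + \<delta> w'"
  have "\<phi> (\<beta> j) = \<phi> (\<beta> j + \<delta> w)" by (simp add: add kernel)
  also have "\<dots> = \<phi> (\<beta> j')" by (simp add: b) (simp add: add kernel)
  finally have "j = j'" using separates j h by (simp add: inj_on_def)
  then show "j = j' \<and> w = w'" using b injD[OF inj] by simp
qed

section \<open>Arithmetic in the field of 27 elements\<close>

text \<open>Additive group of the field; \<open>(x0, x1, x2)\<close> stands for \<open>x0 + x1 t + x2 t\<^sup>2\<close>.\<close>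

type_synonym f27 = "3 \<times> 3 \<times> 3"

text \<open>
  Multiplication in \<open>R[t]\<close> modulo \<open>t\<^sup>3 = t + 2\<close>. The base ring is left open because the product is
  needed over \<open>\<int>/3\<close> in the argument and over \<open>\<int>\<close> in the computation.
\<close>

fun mult27 :: "'a :: comm_ring_1 \<times> 'a \<times> 'a \<Rightarrow> 'a \<times> 'a \<times> 'a \<Rightarrow> 'a \<times> 'a \<times> 'a"
    (infixl "\<odot>" 70) where
  "(x0, x1, x2) \<odot> (y0, y1, y2) =
     (x0 * y0 + 2 * (x1 * y2 + x2 * y1),
      x0 * y1 + x1 * y0 + (x1 * y2 + x2 * y1) + 2 * (x2 * y2),
      x0 * y2 + x1 * y1 + x2 * y0 + x2 * y2)"

lemma mult27_assoc: "(x \<odot> y) \<odot> z = x \<odot> (y \<odot> z)"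
  by (cases x; cases y; cases z) (simp add: algebra_simps)

lemma mult27_add_right: "x \<odot> (y + z) = x \<odot> y + x \<odot> z"
  by (cases x; cases y; cases z) (simp add: algebra_simps)

lemma mult27_diff_left: "(x - y) \<odot> z = x \<odot> z - y \<odot> z"
  by (cases x; cases y; cases z) (simp add: algebra_simps)

lemma mult27_one_left: "(1, 0, 0) \<odot> x = x"
  by (cases x) simp

definition coeff2 :: "'a \<times> 'a \<times> 'a \<Rightarrow> 'a" where
  "coeff2 x = snd (snd x)"

fun residue2 :: "int \<times> int \<Rightarrow> 2 \<times> 2" where
  "residue2 (x, y) = (of_int x, of_int y)"

fun residue3 :: "int \<times> int \<times> int \<Rightarrow> f27" where
  "residue3 (x, y, z) = (of_int x, of_int y, of_int z)"

fun mod2 :: "int \<times> int \<Rightarrow> int \<times> int" where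
  "mod2 (x, y) = (x mod 2, y mod 2)"

fun mod3 :: "int \<times> int \<times> int \<Rightarrow> int \<times> int \<times> int" where
  "mod3 (x, y, z) = (x mod 3, y mod 3, z mod 3)"

lemma of_int_eq_iff_mod2: "(of_int x :: 2) = of_int y \<longleftrightarrow> x mod 2 = y mod 2"
  using of_int_eq_0_iff_char_dvd[where 'a = 2, of "x - y"] by (simp add: mod_eq_dvd_iff)

lemma of_int_eq_iff_mod3: "(of_int x :: 3) = of_int y \<longleftrightarrow> x mod 3 = y mod 3"
  using of_int_eq_0_iff_char_dvd[where 'a = 3, of "x - y"] by (simp add: mod_eq_dvd_iff)

lemma residue2_eq_iff: "residue2 x = residue2 y \<longleftrightarrow> mod2 x = mod2 y"
  by (cases x; cases y) (simp add: of_int_eq_iff_mod2)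

lemma residue3_eq_iff: "residue3 x = residue3 y \<longleftrightarrow> mod3 x = mod3 y"
  by (cases x; cases y) (simp add: of_int_eq_iff_mod3)

lemma residue2_diff: "residue2 (x - y) = residue2 x - residue2 y"
  by (cases x; cases y) simp

lemma residue3_diff: "residue3 (x - y) = residue3 x - residue3 y"
  by (cases x; cases y) simp

lemma residue3_mult: "residue3 (x \<odot> y) = residue3 x \<odot> residue3 y"
  by (cases x; cases y) simp

lemma coeff2_residue3: "coeff2 (residue3 x) = of_int (coeff2 x)"
  by (cases x) (simp add: coeff2_def)

text \<open>
  The power \<open>x\<^sup>2\<^sup>5\<close>, which is the inverse of a non-zero \<open>x\<close> because the multiplicative group has
  order 26. That it inverts the elements in question is computed along with the other conditions.
\<close>

definition inverse27 :: "int \<times> int \<times> int \<Rightarrow> int \<times> int \<times> int" where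
  "inverse27 x = ((\<lambda>y. mod3 (x \<odot> y)) ^^ 24) x"

section \<open>The difference matrix\<close>

text \<open>
  Field elements are tabulated by their ternary digits and elements of \<open>(\<int>/2)\<^sup>2\<close> by their binary
  digits, lowest digit first. The leading quotients are left in the digits, since only residues
  matter.
\<close>

definition digits27 :: "int \<Rightarrow> int \<times> int \<times> int" where
  "digits27 n = (n, n div 3, n div 9)"

definition digits4 :: "int \<Rightarrow> int \<times> int" where
  "digits4 n = (n, n div 2)"

text \<open>
  The tables \<open>a\<close>, \<open>h\<close> and \<open>b\<close>, one line for each row of the matrix. They have a symmetry of order
  three that fixes the last row and rotates the rows within each of the blocks \<open>0..2\<close>, \<open>3..5\<close>,
  \<open>6..8\<close>: it cubes the elements in \<open>a\<close> and \<open>b\<close>, permutes the codes \<open>1, 2, 3\<close> in \<open>h\<close> cyclically, and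
  rotates the columns within each of the four blocks of three.
\<close>

definition a_table :: "int list" where
  "a_table = [4, 3, 5, 12, 15, 11, 22, 20, 25, 2]"

definition h_table :: "int list list" where
  "h_table =
     [[0, 0, 1, 0, 1, 2, 3, 2, 1, 3, 3, 2],
      [2, 0, 0, 3, 0, 2, 2, 1, 3, 3, 1, 1],
      [0, 3, 0, 3, 1, 0, 1, 3, 2, 2, 1, 2],
      [0, 2, 3, 1, 1, 3, 2, 1, 3, 0, 0, 2],
      [1, 0, 3, 1, 2, 2, 1, 3, 2, 3, 0, 0],
      [1, 2, 0, 3, 2, 3, 3, 2, 1, 0, 1, 0],
      [2, 2, 1, 0, 0, 3, 1, 3, 2, 0, 3, 1],
      [2, 3, 3, 1, 0, 0, 3, 2, 1, 2, 0, 1],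
      [1, 3, 1, 0, 2, 0, 2, 1, 3, 2, 3, 0],
      [0, 0, 0, 0, 0, 0, 0, 0, 0, 0, 0, 0]]"

definition b_table :: "int list list" where
  "b_table =
     [[17, 20, 21, 11, 24, 17, 24, 1, 2, 19, 4, 21],
      [19, 10, 25, 10, 12, 21, 2, 21, 1, 19, 24, 3],
      [22, 24, 14, 19, 14, 15, 1, 2, 19, 5, 24, 21],
      [19, 0, 17, 13, 21, 5, 6, 15, 16, 0, 7, 3],
      [10, 24, 0, 4, 16, 19, 9, 7, 11, 5, 0, 8],
      [0, 14, 21, 24, 3, 9, 12, 13, 8, 6, 4, 0],
      [20, 1, 11, 1, 8, 1, 15, 20, 2, 13, 2, 0],
      [12, 25, 1, 1, 1, 6, 2, 11, 25, 0, 16, 2],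
      [1, 15, 22, 7, 1, 1, 22, 2, 12, 2, 0, 9],
      [0, 0, 0, 0, 0, 0, 0, 0, 0, 0, 0, 0]]"

text \<open>
  The condition on two rows that makes their difference injective, in integer arithmetic: apart from
  \<open>c\<close> being inverse to \<open>d = a\<^sub>k - a\<^sub>l\<close>, it says that the twelve values of \<open>h\<^sub>k - h\<^sub>l\<close> together with
  the \<open>t\<^sup>2\<close>-coefficient of \<open>(b\<^sub>k - b\<^sub>l) / d\<close> are distinct.
\<close>

definition separated :: "nat \<Rightarrow> nat \<Rightarrow> bool" where
  "separated k l \<longleftrightarrow>
     (let d = digits27 (a_table ! k) - digits27 (a_table ! l); c = inverse27 d in
      mod3 (c \<odot> d) = (1, 0, 0) \<and>
      distinct (map (\<lambda>j.
        (mod2 (digits4 (h_table ! k ! j) - digits4 (h_table ! l ! j)),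
         coeff2 (c \<odot> (digits27 (b_table ! k ! j) - digits27 (b_table ! l ! j))) mod 3)) [0..<12]))"

lemma separated_table: "\<forall>k\<in>set [0..<10]. \<forall>l\<in>set [0..<k]. separated k l"
  by code_simp

definition dm_entry :: "nat \<Rightarrow> nat \<times> 3 \<times> 3 \<Rightarrow> (2 \<times> 2) \<times> f27" where
  "dm_entry k = (\<lambda>(j, u, v).
     (residue2 (digits4 (h_table ! k ! j)),
      residue3 (digits27 (b_table ! k ! j)) + residue3 (digits27 (a_table ! k)) \<odot> (u, v, 0)))"

text \<open>
  Multiplication by \<open>c = 1 / d\<close> maps \<open>d W\<close> onto \<open>W\<close>, on which the coefficient of \<open>t\<^sup>2\<close> vanishes.
  So \<open>x \<mapsto> coeff2 (c \<odot> x)\<close> is a functional that separates base columns as required.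
\<close>

lemma inj_on_dm_entry_diff:
  assumes "separated k l"
  shows "inj_on (\<lambda>x. dm_entry k x - dm_entry l x) ({..<12} \<times> UNIV)"
proof -
  define d0 where "d0 = digits27 (a_table ! k) - digits27 (a_table ! l)"
  define h0 where "h0 j = digits4 (h_table ! k ! j) - digits4 (h_table ! l ! j)" for j
  define b0 where "b0 j = digits27 (b_table ! k ! j) - digits27 (b_table ! l ! j)" for j
  define c0 where "c0 = inverse27 d0"
  have "mod3 (c0 \<odot> d0) = mod3 (1, 0, 0)"
    and dist: "distinct (map (\<lambda>j. (mod2 (h0 j), coeff2 (c0 \<odot> b0 j) mod 3)) [0..<12])"
    using assms by (auto simp: separated_def d0_def c0_def h0_def b0_def Let_def)
  then have cd: "residue3 c0 \<odot> residue3 d0 = (1, 0, 0)"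
    by (simp only: residue3_eq_iff[symmetric] residue3_mult) simp
  define \<delta> :: "3 \<times> 3 \<Rightarrow> f27" where "\<delta> = (\<lambda>(u, v). residue3 d0 \<odot> (u, v, 0))"
  have c\<delta>: "residue3 c0 \<odot> \<delta> (u, v) = (u, v, 0)" for u v
    by (simp only: \<delta>_def prod.case mult27_assoc[symmetric] cd mult27_one_left)
  have "inj_on (\<lambda>(j, w). (residue2 (h0 j), residue3 (b0 j) + \<delta> w)) ({..<12} \<times> UNIV)"
  proof (rule inj_on_add_translates[where \<phi> = "\<lambda>y. coeff2 (residue3 c0 \<odot> y)"])
    show "coeff2 (residue3 c0 \<odot> (x + y)) = coeff2 (residue3 c0 \<odot> x) + coeff2 (residue3 c0 \<odot> y)"
      for x y by (simp add: mult27_add_right coeff2_def)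
    show "coeff2 (residue3 c0 \<odot> \<delta> w) = 0" for w
      by (cases w) (simp add: c\<delta> coeff2_def)
    show "inj \<delta>"
    proof (rule injI)
      fix w w' assume "\<delta> w = \<delta> w'"
      then have "residue3 c0 \<odot> \<delta> w = residue3 c0 \<odot> \<delta> w'" by simp
      then show "w = w'" by (cases w; cases w') (simp add: c\<delta>)
    qed
    have "inj_on (\<lambda>j. (mod2 (h0 j), coeff2 (c0 \<odot> b0 j) mod 3)) {..<12}"
      using dist by (simp only: distinct_map set_upt atLeast0LessThan)
    then show "inj_on (\<lambda>j. (residue2 (h0 j), coeff2 (residue3 c0 \<odot> residue3 (b0 j)))) {..<12}"
      by (simp add: inj_on_def residue3_mult[symmetric] coeff2_residue3 residue2_eq_iff
          of_int_eq_iff_mod3)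
  qed
  moreover have "dm_entry k x - dm_entry l x
      = (\<lambda>(j, w). (residue2 (h0 j), residue3 (b0 j) + \<delta> w)) x" for x
    by (cases x) (simp add: dm_entry_def h0_def b0_def d0_def \<delta>_def residue2_diff residue3_diff
        mult27_diff_left)
  ultimately show ?thesis by simp
qed

section \<open>Nine squares of order 108\<close>

lemma inj_on_diff_commute:
  fixes f g :: "'c \<Rightarrow> 'g :: ab_group_add"
  shows "inj_on (\<lambda>x. f x - g x) A \<longleftrightarrow> inj_on (\<lambda>x. g x - f x) A"
  unfolding inj_on_def by (metis minus_diff_eq)

lemma mols_108: "\<exists>(V :: nat \<Rightarrow> nat set) L. mols 108 9 V L"
proof -
  have "inj_on (\<lambda>x. dm_entry k x - dm_entry l x) ({..<12} \<times> UNIV)"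
    if "k \<le> 9" "l \<le> 9" "k \<noteq> l" for k l
  proof (cases "l < k")
    case True
    then show ?thesis using separated_table that by (intro inj_on_dm_entry_diff) auto
  next
    case False
    then have "inj_on (\<lambda>x. dm_entry l x - dm_entry k x) ({..<12} \<times> UNIV)"
      using separated_table that by (intro inj_on_dm_entry_diff) auto
    then show ?thesis by (rule inj_on_diff_commute[THEN iffD1])
  qed
  moreover have "card ({..<12 :: nat} \<times> (UNIV :: (3 \<times> 3) set)) = CARD((2 \<times> 2) \<times> f27)"
    by simp
  ultimately have "\<exists>(V :: nat \<Rightarrow> nat set) L. mols CARD((2 \<times> 2) \<times> f27) 9 V L"
    by (intro mols_of_difference_matrix[where f = dm_entry])
  then show ?thesis by simp
qed

theorem theorem3:
  "N 108 \<ge> 9 \<and> (\<exists>(V :: nat \<Rightarrow> nat set) L. mols 108 9 V L)"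
proof
  have "enat 9 \<le> N 108"
    unfolding N_def using mols_108 by (intro Sup_upper) auto
  then show "9 \<le> N 108" by (simp add: numeral_eq_enat)
qed (rule mols_108)

end
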